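(* Let $1<p<\infty$, let $m\ge1$ be an integer, and let $s>1$. There exist a bounded, simply connected Jordan domain $\Omega\subset\mathbb{C}$ and an analytic function $f$ on $\Omega$ such that $\Omega$ has rectifiable boundary, $\Omega$ is an $s$-John domain but not a John domain, and, for every fixed $z_0\in\Omega$, $$ \int_\Omega |f^{(m)}(z)|^p\delta(z)^{mp-2}\,dA(z)=\infty, $$ whereas $$ |f^{(m)}(z_0)|^p\delta(z_0)^{mp}+\int_\Omega |f^{(m+1)}(z)|^p\delta(z)^{(m+1)p-2}\,dA(z)<\infty . $$
   Context: $\delta(z)=\operatorname{dist}(z,\partial\Omega)$ is the Euclidean distance to the boundary and $dA=dx\,dy$ is Euclidean area measure. $f^{(k)}$ denotes the $k$-th complex derivative. $s$-John domain: for $s\ge1$, a bounded domain $\Omega\subset\mathbb{C}$ is an $s$-John domain if there exist a point $x_0\in\Omega$ and a constant $C_J>0$ such that every $x\in\Omega$ can be joined to $x_0$ by a rectifiable curve $\gamma:[0,\ell]\to\Omega$, parametrized by arclength starting from $x$ (so $\gamma(0)=x$, $\gamma(\ell)=x_0$), with $\delta(\gamma(t))\ge C_J t^s$ for $0\le t\le\ell$. A John domain is a $1$-John domain. *)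

theory Defs
  imports "HOL-Analysis.Analysis"
begin

definition bdist :: "complex set \<Rightarrow> complex \<Rightarrow> real" where
  "bdist \<Omega> z = infdist z (frontier \<Omega>)"

definition domain :: "complex set \<Rightarrow> bool" where
  "domain \<Omega> \<longleftrightarrow> open \<Omega> \<and> connected \<Omega> \<and> \<Omega> \<noteq> {}"

(* The supremum of the lengths of the inscribed polygons g (t 0), ..., g (t n),
   over all partitions a = t 0 \<le> ... \<le> t n = b. *)
definition curve_length :: "(real \<Rightarrow> complex) \<Rightarrow> real \<Rightarrow> real \<Rightarrow> ennreal" where
  "curve_length g a b =
     (SUP (n, t) \<in> {(n :: nat, t :: nat \<Rightarrow> real).
                      t 0 = a \<and> t n = b \<and> (\<forall>i<n. t i \<le> t (Suc i))}.
        \<Sum>i<n. ennreal (dist (g (t i)) (g (t (Suc i)))))"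

definition arclength_curve :: "(real \<Rightarrow> complex) \<Rightarrow> real \<Rightarrow> bool" where
  "arclength_curve g l \<longleftrightarrow>
     0 \<le> l \<and> continuous_on {0..l} g \<and> (\<forall>t\<in>{0..l}. curve_length g 0 t = ennreal t)"

definition s_john_domain :: "real \<Rightarrow> complex set \<Rightarrow> bool" where
  "s_john_domain s \<Omega> \<longleftrightarrow>
     1 \<le> s \<and> domain \<Omega> \<and> bounded \<Omega> \<and>
     (\<exists>x0\<in>\<Omega>. \<exists>C>0. \<forall>x\<in>\<Omega>. \<exists>g l.
        arclength_curve g l \<and> g ` {0..l} \<subseteq> \<Omega> \<and> g 0 = x \<and> g l = x0 \<and>
        (\<forall>t\<in>{0..l}. bdist \<Omega> (g t) \<ge> C * t powr s))"

definition john_domain :: "complex set \<Rightarrow> bool" where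
  "john_domain \<Omega> \<longleftrightarrow> s_john_domain 1 \<Omega>"

definition closed_simple_path :: "(real \<Rightarrow> complex) \<Rightarrow> bool" where
  "closed_simple_path c \<longleftrightarrow> simple_path c \<and> pathfinish c = pathstart c"

(* Boundedness is included because the exterior of a Jordan curve has the same frontier. *)
definition jordan_domain :: "complex set \<Rightarrow> bool" where
  "jordan_domain \<Omega> \<longleftrightarrow>
     domain \<Omega> \<and> bounded \<Omega> \<and> (\<exists>c. closed_simple_path c \<and> path_image c = frontier \<Omega>)"

definition rectifiable_boundary :: "complex set \<Rightarrow> bool" where
  "rectifiable_boundary \<Omega> \<longleftrightarrow>
     (\<exists>c. closed_simple_path c \<and> path_image c = frontier \<Omega> \<and> curve_length c 0 1 < \<infinity>)"

end

theory Submission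
  imports Defs
begin

text \<open>The domain is \<open>{x + i y. \<bar>y\<bar> < (1 - \<bar>x\<bar>) powr s}\<close>, which has outward power cusps of order \<open>s\<close>
  at \<open>- 1\<close> and \<open>1\<close>. It is starlike about \<open>0\<close>, and the straight segments to \<open>0\<close> already satisfy the
  \<open>s\<close>-John condition; a curve leaving the cusp gets within \<open>\<epsilon> powr s\<close> of the boundary after length
  about \<open>\<epsilon>\<close>, so the John condition fails. Near \<open>- 1\<close> the function \<open>f\<close> is chosen such that
  \<open>\<bar>f\<^sup>(\<^sup>m\<^sup>)\<bar>\<close> is a multiple of \<open>\<bar>z + 1\<bar> powr - b\<close>, with \<open>b\<close> making the first integral diverge
  exactly logarithmically. Passing to the next derivative costs a factor \<open>\<bar>z + 1\<bar> powr - p\<close>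
  but the weight gains \<open>\<delta> powr p\<close>, which is at most \<open>\<bar>z + 1\<bar> powr (s * p)\<close>; since \<open>s > 1\<close>, this
  makes the second integral converge.\<close>

section \<open>Inequalities for real powers\<close>

lemma powr_Lipschitz_unit_interval:
  fixes u v s :: real
  assumes "1 \<le> s" "u \<in> {0..1}" "v \<in> {0..1}"
  shows "\<bar>u powr s - v powr s\<bar> \<le> s * \<bar>u - v\<bar>"
proof -
  have *: "\<bar>u powr s - v powr s\<bar> \<le> s * \<bar>u - v\<bar>" if uv: "u < v" "0 \<le> u" "v \<le> 1" for u v
  proof -
    have cont: "continuous_on {u..v} (\<lambda>x. x powr s)"
      using that assms by (intro continuous_on_powr' continuous_intros) auto
    have deriv: "((\<lambda>x. x powr s) has_derivative (*) (s * x powr (s - 1))) (at x)" if "u < x" for x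
      using has_real_derivative_powr[of x s] that \<open>0 \<le> u\<close> by (simp add: has_field_derivative_def)
    obtain \<xi> where \<xi>: "u < \<xi>" "\<xi> < v" "v powr s - u powr s = s * \<xi> powr (s - 1) * (v - u)"
      using mvt[OF uv(1) cont deriv] by blast
    have "\<xi> powr (s - 1) \<le> 1"
      using \<xi> that assms by (intro powr_le1) auto
    then have "s * \<xi> powr (s - 1) * (v - u) \<le> s * 1 * (v - u)"
      using that assms by (intro mult_right_mono mult_left_mono) auto
    moreover have "u powr s \<le> v powr s"
      using that assms by (intro powr_mono2) auto
    ultimately show ?thesis using \<xi> that by simp
  qed
  show ?thesis
    using *[of u v] *[of v u] assms by (cases u v rule: linorder_cases) (auto simp: abs_minus_commute)
qed

text \<open>Writing x^s as x * x^(s-1), both factors x^(s-1) are bounded by (a+b)^(s-1), because s -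
  1 is nonnegative.\<close>

lemma powr_superadditive:
  fixes a b s :: real
  assumes "1 \<le> s" "0 \<le> a" "0 \<le> b"
  shows "a powr s + b powr s \<le> (a + b) powr s"
proof -
  have eq: "x powr s = x * x powr (s - 1)" if "0 \<le> x" for x
    using that powr_mult_base[of x "s - 1"] by simp
  have "a * a powr (s - 1) + b * b powr (s - 1) \<le> a * (a + b) powr (s - 1) + b * (a + b) powr (s - 1)"
    using assms by (intro add_mono mult_left_mono powr_mono2) auto
  also have "\<dots> = (a + b) * (a + b) powr (s - 1)"
    by (simp add: distrib_right)
  finally show ?thesis
    unfolding eq[OF assms(2), symmetric] eq[OF assms(3), symmetric] eq[OF add_nonneg_nonneg[OF assms(2,3)], symmetric] .
qed

text \<open>With T the horizontal distance of a boundary point from its cusp, the right-hand side is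
  the vertical gap left after scaling that point by 1 - \<tau>. If T is at least 1/2, the gap comes
  from the loss of height \<tau> * T^s; otherwise the distance to the cusp grows by at least
  \<tau>/2 and superadditivity applies.\<close>

lemma powr_segment_gap:
  fixes s T \<tau> :: real
  assumes "1 \<le> s" "T \<in> {0..1}" "\<tau> \<in> {0..1}"
  shows "(\<tau> / 2) powr s \<le> (T + \<tau> * (1 - T)) powr s - (1 - \<tau>) * T powr s"
proof (cases "T \<ge> 1/2")
  case True
  have "T powr s \<le> (T + \<tau> * (1 - T)) powr s"
    using assms by (intro powr_mono2) auto
  moreover have "(\<tau> / 2) powr s \<le> \<tau> * T powr s"
  proof -
    have "(\<tau> / 2) powr s = \<tau> powr s * (1/2) powr s"
      using assms powr_mult[of \<tau> "1/2" s] by simp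
    also have "\<dots> \<le> \<tau> * T powr s"
      using True assms powr_mono'[of 1 s \<tau>]
      by (intro mult_mono powr_mono2) auto
    finally show ?thesis .
  qed
  ultimately show ?thesis by (simp add: algebra_simps)
next
  case False
  have "\<tau> * (1/2) \<le> \<tau> * (1 - T)"
    using False assms by (intro mult_left_mono) auto
  have "T powr s + (\<tau> / 2) powr s \<le> (T + \<tau> / 2) powr s"
    using assms by (intro powr_superadditive) auto
  also have "\<dots> \<le> (T + \<tau> * (1 - T)) powr s"
    using assms \<open>\<tau> * (1/2) \<le> \<tau> * (1 - T)\<close> by (intro powr_mono2) auto
  finally show ?thesis using assms by (simp add: algebra_simps add_increasing)
qed

text \<open>Serves a weight whose exponent may have either sign: m p - 2 is negative for m = 1 and p
  < 2. A nonnegative exponent uses the lower bound on d, a negative one the upper bound; the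
  absolute value in the constant covers both.\<close>

lemma powr_lower_scale:
  fixes a c d \<phi> :: real
  assumes "0 < c" "c \<le> 1" "0 < \<phi>" "c * \<phi> \<le> d" "d \<le> \<phi>"
  shows "c powr \<bar>a\<bar> * \<phi> powr a \<le> d powr a"
proof (cases "0 \<le> a")
  case True
  have "c powr \<bar>a\<bar> * \<phi> powr a = (c * \<phi>) powr a"
    using assms True by (simp add: powr_mult)
  also have "\<dots> \<le> d powr a" using assms True by (intro powr_mono2) auto
  finally show ?thesis .
next
  case False
  have d: "0 < d" using assms by (meson mult_pos_pos less_le_trans)
  have "c powr \<bar>a\<bar> \<le> 1" using assms by (intro powr_le1) auto
  then have "c powr \<bar>a\<bar> * \<phi> powr a \<le> 1 * \<phi> powr a"
    by (intro mult_right_mono) auto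
  also have "\<dots> \<le> d powr a" using assms d False powr_mono2'[of a d \<phi>] by simp
  finally show ?thesis .
qed

section \<open>Area integrals over the complex plane as iterated integrals\<close>

lemma measurable_Complex_pair:
  "(\<lambda>(x, y). Complex x y) \<in> borel_measurable (lborel \<Otimes>\<^sub>M lborel)"
proof -
  have "(\<lambda>w. Complex (fst w) (snd w)) \<in> borel_measurable borel"
    unfolding Complex_eq by (intro borel_measurable_continuous_onI continuous_intros)
  then show ?thesis by (simp add: lborel_prod case_prod_beta)
qed

text \<open>Lebesgue measure is determined by its values on boxes, and the image of the product
  measure gives a box the product of its side lengths.\<close>

lemma lborel_complex_eq_distr:
  "(lborel :: complex measure) = distr (lborel \<Otimes>\<^sub>M lborel) borel (\<lambda>(x, y). Complex x y)"
proof (rule lborel_eqI)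
  fix l u :: complex
  assume "\<And>b. b \<in> Basis \<Longrightarrow> l \<bullet> b \<le> u \<bullet> b"
  from this[of 1] this[of \<i>] have lu: "Re l \<le> Re u" "Im l \<le> Im u"
    by (auto simp: Basis_complex_def)
  have m: "(\<lambda>(x, y). Complex x y) \<in> borel_measurable (lborel \<Otimes>\<^sub>M lborel)"
    by (rule measurable_Complex_pair)
  have "(\<lambda>(x, y). Complex x y) -` box l u \<inter> space (lborel \<Otimes>\<^sub>M lborel)
      = {Re l<..<Re u} \<times> {Im l<..<Im u}"
    by (auto simp: space_pair_measure in_box_complex_iff)
  then have "emeasure (distr (lborel \<Otimes>\<^sub>M lborel) borel (\<lambda>(x, y). Complex x y)) (box l u)
      = emeasure (lborel \<Otimes>\<^sub>M lborel) ({Re l<..<Re u} \<times> {Im l<..<Im u})"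
    using m by (simp add: emeasure_distr)
  also have "\<dots> = ennreal (Re u - Re l) * ennreal (Im u - Im l)"
    using lu by (subst lborel.emeasure_pair_measure_Times) auto
  also have "\<dots> = ennreal (\<Prod>b\<in>Basis. (u - l) \<bullet> b)"
    using lu by (simp add: Basis_complex_def ennreal_mult)
  finally show "emeasure (distr (lborel \<Otimes>\<^sub>M lborel) borel (\<lambda>(x, y). Complex x y)) (box l u)
      = ennreal (\<Prod>b\<in>Basis. (u - l) \<bullet> b)" .
qed simp

lemma nn_integral_complex_iterated:
  fixes f :: "complex \<Rightarrow> ennreal"
  assumes [measurable]: "f \<in> borel_measurable borel"
  shows "(\<integral>\<^sup>+z. f z \<partial>lborel) = (\<integral>\<^sup>+x. \<integral>\<^sup>+y. f (Complex x y) \<partial>lborel \<partial>lborel)"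
proof -
  have m [measurable]: "(\<lambda>(x, y). Complex x y) \<in> borel_measurable (lborel \<Otimes>\<^sub>M lborel)"
    by (rule measurable_Complex_pair)
  have "(\<integral>\<^sup>+z. f z \<partial>lborel) = (\<integral>\<^sup>+w. f (case w of (x, y) \<Rightarrow> Complex x y) \<partial>(lborel \<Otimes>\<^sub>M lborel))"
    by (subst lborel_complex_eq_distr) (simp add: nn_integral_distr)
  also have "\<dots> = (\<integral>\<^sup>+x. \<integral>\<^sup>+y. f (Complex x y) \<partial>lborel \<partial>lborel)"
    by (subst lborel.nn_integral_fst[symmetric]) auto
  finally show ?thesis .
qed

section \<open>Length of curves\<close>

lemma curve_length_ge_dist:
  assumes "a \<le> b"
  shows "ennreal (dist (g a) (g b)) \<le> curve_length g a b"
proof -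
  have "(\<Sum>i<1. ennreal (dist (g ((\<lambda>i. if i = 0 then a else b) i)) (g ((\<lambda>i. if i = 0 then a else b) (Suc i)))))
      \<le> curve_length g a b"
    unfolding curve_length_def
    by (rule SUP_upper2[where i = "(1, \<lambda>i::nat. if i = 0 then a else b)"]) (use assms in auto)
  then show ?thesis by simp
qed

text \<open>The bounds for the sides of an inscribed polygon telescope over the partition.\<close>

lemma curve_length_Lipschitz:
  assumes "0 \<le> K" and "\<And>x y. a \<le> x \<Longrightarrow> x \<le> y \<Longrightarrow> y \<le> b \<Longrightarrow> dist (g x) (g y) \<le> K * (y - x)"
  shows "curve_length g a b \<le> ennreal (K * (b - a))"
  unfolding curve_length_def
proof (rule SUP_least, clarify)
  fix n :: nat and t :: "nat \<Rightarrow> real"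
  assume ab: "a = t 0" "b = t n" and inc: "\<forall>i<n. t i \<le> t (Suc i)"
  have mono: "t i \<le> t j" if "i \<le> j" "j \<le> n" for i j
    using that
  proof (induction j rule: dec_induct)
    case (step k)
    then have "t i \<le> t k" "t k \<le> t (Suc k)" using inc by auto
    then show ?case by (rule order_trans)
  qed simp
  have "(\<Sum>i<n. ennreal (dist (g (t i)) (g (t (Suc i))))) = ennreal (\<Sum>i<n. dist (g (t i)) (g (t (Suc i))))"
    by (rule sum_ennreal) simp
  also have "\<dots> \<le> ennreal (\<Sum>i<n. K * (t (Suc i) - t i))"
    using mono assms(2) ab by (intro ennreal_leI sum_mono) auto
  also have "(\<Sum>i<n. K * (t (Suc i) - t i)) = K * (t n - t 0)"
    by (simp add: sum_distrib_left[symmetric] sum_lessThan_telescope)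
  finally show "(\<Sum>i<n. ennreal (dist (g (t i)) (g (t (Suc i))))) \<le> ennreal (K * (t n - t 0))" .
qed

lemma arclength_curve_line:
  fixes z u :: complex
  assumes "norm u = 1" "0 \<le> l"
  shows "arclength_curve (\<lambda>t. z + of_real t * u) l"
  unfolding arclength_curve_def
proof (intro conjI ballI)
  fix t assume "t \<in> {0..l}"
  have dist: "dist (z + of_real x * u) (z + of_real y * u) = \<bar>x - y\<bar>" for x y :: real
    using assms by (simp add: dist_norm norm_mult flip: left_diff_distrib of_real_diff)
  show "curve_length (\<lambda>t. z + of_real t * u) 0 t = ennreal t"
  proof (rule antisym)
    show "curve_length (\<lambda>t. z + of_real t * u) 0 t \<le> ennreal t"
      using curve_length_Lipschitz[of 1 0 t "\<lambda>t. z + of_real t * u"] dist by simp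
    show "ennreal t \<le> curve_length (\<lambda>t. z + of_real t * u) 0 t"
      using curve_length_ge_dist[of 0 t "\<lambda>t. z + of_real t * u"] dist[of 0 t] \<open>t \<in> {0..l}\<close> by simp
  qed
qed (use assms in \<open>auto intro!: continuous_intros\<close>)

section \<open>The cusp domain, its frontier and the distance to it\<close>

text \<open>Truncating at 0 extends the profile by zero to the whole line, where it is globally
  Lipschitz with constant s when s is at least 1.\<close>

definition cusp_profile :: "real \<Rightarrow> real \<Rightarrow> real" where
  "cusp_profile s x = (max 0 (1 - \<bar>x\<bar>)) powr s"

definition cusp_domain :: "real \<Rightarrow> complex set" where
  "cusp_domain s = {z. \<bar>Im z\<bar> < cusp_profile s (Re z)}"

lemma cusp_profile_eq: "\<bar>x\<bar> \<le> 1 \<Longrightarrow> cusp_profile s x = (1 - \<bar>x\<bar>) powr s"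
  by (simp add: cusp_profile_def)

lemma cusp_profile_nonneg [simp]: "0 \<le> cusp_profile s x"
  by (simp add: cusp_profile_def)

lemma cusp_profile_pos_iff: "0 < cusp_profile s x \<longleftrightarrow> \<bar>x\<bar> < 1"
  by (auto simp: cusp_profile_def)

lemma cusp_profile_eq_0_iff: "cusp_profile s x = 0 \<longleftrightarrow> 1 \<le> \<bar>x\<bar>"
  by (auto simp: cusp_profile_def)

lemma cusp_profile_le_1: "0 \<le> s \<Longrightarrow> cusp_profile s x \<le> 1"
  unfolding cusp_profile_def by (intro powr_le1) auto

lemma cusp_profile_le_linear:
  assumes "1 \<le> s" shows "cusp_profile s x \<le> max 0 (1 - \<bar>x\<bar>)"
  using powr_mono'[of 1 s "max 0 (1 - \<bar>x\<bar>)"] assms unfolding cusp_profile_def by simp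

lemma cusp_profile_Lipschitz:
  assumes "1 \<le> s"
  shows "\<bar>cusp_profile s x - cusp_profile s y\<bar> \<le> s * \<bar>x - y\<bar>"
proof -
  have "\<bar>cusp_profile s x - cusp_profile s y\<bar> \<le> s * \<bar>max 0 (1 - \<bar>x\<bar>) - max 0 (1 - \<bar>y\<bar>)\<bar>"
    unfolding cusp_profile_def using assms by (intro powr_Lipschitz_unit_interval) auto
  also have "\<dots> \<le> s * \<bar>x - y\<bar>" using assms by (intro mult_left_mono) auto
  finally show ?thesis .
qed

lemma continuous_on_cusp_profile [continuous_intros]:
  assumes "1 \<le> s" "continuous_on A f"
  shows "continuous_on A (\<lambda>x. cusp_profile s (f x))"
  unfolding cusp_profile_def using assms
  by (intro continuous_on_powr' continuous_intros) auto

lemma open_cusp_domain: "1 \<le> s \<Longrightarrow> open (cusp_domain s)"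
  unfolding cusp_domain_def by (intro open_Collect_less continuous_intros) auto

lemma cusp_domain_Re: "z \<in> cusp_domain s \<Longrightarrow> \<bar>Re z\<bar> < 1"
  using cusp_profile_pos_iff[of s "Re z"] by (auto simp: cusp_domain_def)

lemma zero_in_cusp_domain: "0 \<in> cusp_domain s"
  by (simp add: cusp_domain_def cusp_profile_def)

lemma cusp_domain_cmod_le:
  assumes "1 \<le> s" "z \<in> cusp_domain s" shows "norm z \<le> 2"
  using cmod_le[of z] cusp_domain_Re[OF assms(2)] cusp_profile_le_1[of s "Re z"] assms
  by (auto simp: cusp_domain_def)

lemma bounded_cusp_domain: "1 \<le> s \<Longrightarrow> bounded (cusp_domain s)"
  using cusp_domain_cmod_le unfolding bounded_iff by blast

text \<open>The gap between height and profile at (1 - \<tau>) z, for z in the closed region,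
  follows from \<open>powr_segment_gap\<close> with T = 1 - |Re z|. Starlikeness, the frontier and
  the s-John estimate all rest on it.\<close>

lemma cusp_profile_segment_gap:
  assumes "1 \<le> s" "\<bar>Re z\<bar> \<le> 1" "\<bar>Im z\<bar> \<le> cusp_profile s (Re z)" "\<tau> \<in> {0..1}"
  shows "(\<tau> / 2) powr s \<le> cusp_profile s ((1 - \<tau>) * Re z) - \<bar>(1 - \<tau>) * Im z\<bar>"
proof -
  define T where "T = 1 - \<bar>Re z\<bar>"
  have T: "T \<in> {0..1}" using assms by (auto simp: T_def)
  have "\<bar>(1 - \<tau>) * Re z\<bar> \<le> 1"
    using assms by (simp add: abs_mult mult_le_one)
  moreover have "1 - \<bar>(1 - \<tau>) * Re z\<bar> = T + \<tau> * (1 - T)"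
  proof -
    have "\<bar>(1 - \<tau>) * Re z\<bar> = (1 - \<tau>) * \<bar>Re z\<bar>"
      using assms by (simp add: abs_mult)
    then show ?thesis by (simp add: T_def algebra_simps)
  qed
  ultimately have 1: "cusp_profile s ((1 - \<tau>) * Re z) = (T + \<tau> * (1 - T)) powr s"
    by (simp add: cusp_profile_eq)
  have "\<bar>(1 - \<tau>) * Im z\<bar> \<le> (1 - \<tau>) * T powr s"
    using assms by (auto simp: abs_mult T_def cusp_profile_eq intro!: mult_left_mono)
  then show ?thesis using powr_segment_gap[OF assms(1) T assms(4)] 1 by linarith
qed

lemma cusp_domain_scale:
  assumes "1 \<le> s" "\<bar>Re z\<bar> \<le> 1" "\<bar>Im z\<bar> \<le> cusp_profile s (Re z)" "0 < \<tau>" "\<tau> \<le> 1"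
  shows "of_real (1 - \<tau>) * z \<in> cusp_domain s"
proof -
  have "0 < (\<tau> / 2) powr s" using assms by simp
  also have "\<dots> \<le> cusp_profile s ((1 - \<tau>) * Re z) - \<bar>(1 - \<tau>) * Im z\<bar>"
    using assms by (intro cusp_profile_segment_gap) auto
  finally show ?thesis by (simp add: cusp_domain_def)
qed

lemma starlike_cusp_domain:
  assumes "1 \<le> s" shows "starlike (cusp_domain s)"
  unfolding starlike_def
proof (intro bexI ballI subsetI)
  fix z w assume z: "z \<in> cusp_domain s" and "w \<in> closed_segment 0 z"
  then obtain u where u: "0 \<le> u" "u \<le> 1" "w = of_real u * z"
    by (auto simp: in_segment scaleR_conv_of_real)
  show "w \<in> cusp_domain s"
  proof (cases "u = 1")
    case False
    then show ?thesis
      using cusp_domain_scale[of s z "1 - u"] assms z cusp_domain_Re[OF z] u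
      by (auto simp: cusp_domain_def)
  qed (use z u in simp)
qed (rule zero_in_cusp_domain)

lemma domain_cusp_domain: "1 \<le> s \<Longrightarrow> domain (cusp_domain s)"
  unfolding domain_def
  using open_cusp_domain starlike_cusp_domain starlike_imp_connected zero_in_cusp_domain by blast

text \<open>The closed region contains the closure. Conversely, each point of the bounding graphs is
  a limit of its own scalings towards 0, which lie in the domain.\<close>

lemma frontier_cusp_domain:
  assumes "1 \<le> s"
  shows "frontier (cusp_domain s) = {z. \<bar>Re z\<bar> \<le> 1 \<and> \<bar>Im z\<bar> = cusp_profile s (Re z)}"
proof -
  have "cusp_domain s \<subseteq> {z. \<bar>Re z\<bar> \<le> 1 \<and> \<bar>Im z\<bar> \<le> cusp_profile s (Re z)}"
    using cusp_domain_Re by (auto simp: cusp_domain_def less_imp_le)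
  moreover have "closed {z. \<bar>Re z\<bar> \<le> 1 \<and> \<bar>Im z\<bar> \<le> cusp_profile s (Re z)}"
    using assms by (intro closed_Collect_conj closed_Collect_le continuous_intros) auto
  ultimately have 1: "closure (cusp_domain s) \<subseteq> {z. \<bar>Re z\<bar> \<le> 1 \<and> \<bar>Im z\<bar> \<le> cusp_profile s (Re z)}"
    by (rule closure_minimal)
  have 2: "z \<in> closure (cusp_domain s)" if z: "\<bar>Re z\<bar> \<le> 1" "\<bar>Im z\<bar> = cusp_profile s (Re z)" for z
    unfolding closure_sequential
  proof (intro exI conjI allI)
    show "of_real (1 - 1 / real (Suc n)) * z \<in> cusp_domain s" for n
      using z assms by (intro cusp_domain_scale) auto
    have "(\<lambda>n. of_real (1 - 1 / real (Suc n)) * z) \<longlonglongrightarrow> of_real (1 - 0) * z"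
      using LIMSEQ_inverse_real_of_nat by (intro tendsto_intros) (simp add: inverse_eq_divide)
    then show "(\<lambda>n. of_real (1 - 1 / real (Suc n)) * z) \<longlonglongrightarrow> z" by simp
  qed
  have *: "z \<in> frontier (cusp_domain s) \<longleftrightarrow>
      z \<in> closure (cusp_domain s) \<and> cusp_profile s (Re z) \<le> \<bar>Im z\<bar>" for z
    using open_cusp_domain[OF assms] by (simp add: frontier_def interior_open cusp_domain_def not_less)
  show ?thesis
  proof (intro set_eqI iffI)
    fix z assume "z \<in> frontier (cusp_domain s)"
    then show "z \<in> {z. \<bar>Re z\<bar> \<le> 1 \<and> \<bar>Im z\<bar> = cusp_profile s (Re z)}"
      using 1 * by force
  next
    fix z assume "z \<in> {z. \<bar>Re z\<bar> \<le> 1 \<and> \<bar>Im z\<bar> = cusp_profile s (Re z)}"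
    then show "z \<in> frontier (cusp_domain s)"
      using 2 * by simp
  qed
qed

text \<open>The function \<open>cusp_profile s (Re z) - \<bar>Im z\<bar>\<close> is Lipschitz with
  constant s + 1 and vanishes on the frontier.\<close>

lemma bdist_cusp_domain_ge:
  assumes "1 \<le> s"
  shows "(cusp_profile s (Re z) - \<bar>Im z\<bar>) / (s + 1) \<le> bdist (cusp_domain s) z"
proof -
  let ?F = "frontier (cusp_domain s)"
  \<comment> \<open>The infimum over the frontier needs a nonempty set, since \<open>infdist\<close>
    to the empty set is 0 by convention.\<close>
  have "1 \<in> ?F" by (simp add: frontier_cusp_domain assms cusp_profile_def)
  moreover have "(cusp_profile s (Re z) - \<bar>Im z\<bar>) / (s + 1) \<le> dist z w" if "w \<in> ?F" for w
  proof -
    have "cusp_profile s (Re z) - \<bar>Im z\<bar>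
        = (cusp_profile s (Re z) - cusp_profile s (Re w)) + (\<bar>Im w\<bar> - \<bar>Im z\<bar>)"
      using that by (simp add: frontier_cusp_domain assms)
    also have "\<dots> \<le> s * \<bar>Re z - Re w\<bar> + \<bar>Im z - Im w\<bar>"
      using cusp_profile_Lipschitz[OF assms, of "Re z" "Re w"] by linarith
    also have "\<dots> \<le> s * dist z w + dist z w"
      using abs_Re_le_cmod[of "z - w"] abs_Im_le_cmod[of "z - w"] assms
      by (intro add_mono mult_left_mono) (auto simp: dist_norm)
    finally show ?thesis using assms by (simp add: field_simps)
  qed
  ultimately show ?thesis
    unfolding bdist_def infdist_def by (auto intro: cINF_greatest)
qed

text \<open>Compares with the boundary point vertically above or below z, on the side of the sign of
  Im z.\<close>

lemma bdist_cusp_domain_le: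
  assumes "1 \<le> s" "z \<in> cusp_domain s"
  shows "bdist (cusp_domain s) z \<le> cusp_profile s (Re z)"
proof -
  define w where "w = Complex (Re z) (if 0 \<le> Im z then cusp_profile s (Re z) else - cusp_profile s (Re z))"
  have "w \<in> frontier (cusp_domain s)"
    using cusp_domain_Re[OF assms(2)] by (simp add: frontier_cusp_domain assms w_def)
  then have "bdist (cusp_domain s) z \<le> dist z w"
    unfolding bdist_def by (rule infdist_le)
  also have "\<dots> \<le> cusp_profile s (Re z)"
    using assms(2) cmod_le[of "z - w"] by (auto simp: dist_norm w_def cusp_domain_def split: if_splits)
  finally show ?thesis .
qed

section \<open>The John conditions\<close>

lemma s_john_cusp_domain:
  assumes "1 \<le> s"
  shows "s_john_domain s (cusp_domain s)"
proof -
  \<comment> \<open>The factor 1/4 combines the \<tau>/2 of the gap estimate with |z| \<le> 2, which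
    gives t/4 \<le> \<tau>/2 for t = \<tau> |z|. The divisor s + 1 turns the gap into a
    distance.\<close>
  define C where "C = (1/4) powr s / (s + 1)"
  have C: "0 < C" using assms by (simp add: C_def)
  have "\<exists>g l. arclength_curve g l \<and> g ` {0..l} \<subseteq> cusp_domain s \<and> g 0 = z \<and> g l = 0 \<and>
        (\<forall>t\<in>{0..l}. bdist (cusp_domain s) (g t) \<ge> C * t powr s)" if z: "z \<in> cusp_domain s" for z
  proof -
    define l where "l = norm z"
    \<comment> \<open>The unit direction from z towards 0; for z = 0 the curve has length 0 and any
      unit vector serves.\<close>
    define u where "u = (if z = 0 then 1 else - sgn z)"
    define g where "g t = z + of_real t * u" for t :: real
    have u: "norm u = 1" and zl: "z = - of_real l * u"
      by (auto simp: u_def norm_sgn l_def sgn_eq norm_divide)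
    have "arclength_curve g l"
      unfolding g_def using u by (intro arclength_curve_line) (auto simp: l_def)
    moreover have "g 0 = z" "g l = 0"
      using zl by (auto simp: g_def)
    moreover have "g t \<in> cusp_domain s \<and> C * t powr s \<le> bdist (cusp_domain s) (g t)"
      if t: "t \<in> {0..l}" for t
    proof (cases "t = 0")
      case True
      then show ?thesis using z by (simp add: g_def bdist_def infdist_nonneg)
    next
      case False
      then have "0 < l" using t by auto
      define \<tau> where "\<tau> = t / l"
      have \<tau>: "0 < \<tau>" "\<tau> \<le> 1" "t = \<tau> * l"
        using t False \<open>0 < l\<close> by (auto simp: \<tau>_def)
      have gt: "g t = of_real (1 - \<tau>) * z"
        unfolding g_def using zl \<tau>(3) by (simp add: algebra_simps)
      have z': "\<bar>Re z\<bar> \<le> 1" "\<bar>Im z\<bar> \<le> cusp_profile s (Re z)"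
        using z cusp_domain_Re[OF z] by (auto simp: cusp_domain_def)
      have "(1/4) powr s * t powr s = (t / 4) powr s"
        using powr_mult[of "1/4" t s] t by simp
      also have "\<dots> \<le> (\<tau> / 2) powr s"
      proof (rule powr_mono2)
        have "\<tau> * l \<le> \<tau> * 2"
          using cusp_domain_cmod_le[OF assms z] \<tau> by (intro mult_left_mono) (auto simp: l_def)
        then show "t / 4 \<le> \<tau> / 2" using \<tau>(3) by simp
      qed (use assms t in auto)
      also have "\<dots> \<le> cusp_profile s (Re (g t)) - \<bar>Im (g t)\<bar>"
        using cusp_profile_segment_gap[OF assms z', of \<tau>] \<tau> gt by simp
      finally have "C * t powr s \<le> (cusp_profile s (Re (g t)) - \<bar>Im (g t)\<bar>) / (s + 1)"
        using assms by (simp add: C_def divide_right_mono)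
      also have "\<dots> \<le> bdist (cusp_domain s) (g t)"
        by (rule bdist_cusp_domain_ge[OF assms])
      finally show ?thesis
        using cusp_domain_scale[OF assms z' \<tau>(1,2)] gt by simp
    qed
    ultimately show ?thesis
      by (intro exI[of _ g] exI[of _ l] conjI) auto
  qed
  then show ?thesis
    unfolding s_john_domain_def
    using assms C domain_cusp_domain[OF assms] bounded_cusp_domain[OF assms]
    by (intro conjI bexI[OF _ zero_in_cusp_domain] exI[of _ C]) simp_all
qed

lemma not_john_cusp_domain:
  assumes "1 < s"
  shows "\<not> john_domain (cusp_domain s)"
proof
  let ?\<Omega> = "cusp_domain s"
  assume "john_domain ?\<Omega>"
  \<comment> \<open>Folding the curve condition into a predicate keeps its quantifiers out of the
    search for the centre and the constant.\<close>
  moreover define Q where "Q x0 C x \<longleftrightarrow> (\<exists>g l. arclength_curve g l \<and> g ` {0..l} \<subseteq> ?\<Omega> \<and>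
      g 0 = x \<and> g l = x0 \<and> (\<forall>t\<in>{0..l}. bdist ?\<Omega> (g t) \<ge> C * t powr 1))" for x0 C x
  ultimately have "\<exists>x0\<in>?\<Omega>. \<exists>C>0. \<forall>x\<in>?\<Omega>. Q x0 C x"
    unfolding john_domain_def s_john_domain_def Q_def by (elim conjE)
  then obtain x0 C where x0: "x0 \<in> ?\<Omega>" and C: "0 < C" and curves: "\<And>x. x \<in> ?\<Omega> \<Longrightarrow> Q x0 C x"
    by blast
  \<comment> \<open>The first two bounds put the line Re = 2 e - 1 to the left of 0 and of x0. The
    third makes (2 e)^s smaller than C e, which is possible because s > 1.\<close>
  define e where "e = min (min (1/4) ((1 + Re x0) / 4)) ((C / (2 * 2 powr s)) powr (1 / (s - 1)))"
  have e: "e < 1/2" "2 * e < 1 + Re x0" "0 < e"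
  proof -
    have "e \<le> 1/4" "e \<le> (1 + Re x0) / 4"
      unfolding e_def by (rule min.coboundedI1, rule min.cobounded1 min.cobounded2)+
    then show "e < 1/2" "2 * e < 1 + Re x0" using cusp_domain_Re[OF x0] by auto
    show "0 < e" using cusp_domain_Re[OF x0] C by (auto simp: e_def)
  qed
  have "e powr (s - 1) \<le> ((C / (2 * 2 powr s)) powr (1 / (s - 1))) powr (s - 1)"
    using e assms by (intro powr_mono2) (auto simp: e_def)
  also have "\<dots> = C / (2 * 2 powr s)"
    using assms C by (simp add: powr_powr)
  finally have "2 powr s * e powr (s - 1) \<le> C / 2"
    by (simp add: field_simps)
  then have small: "2 powr s * e powr (s - 1) < C" using C by simp
  define x where "x = complex_of_real (e - 1)"
  have "x \<in> ?\<Omega>" using e by (simp add: x_def cusp_domain_def cusp_profile_pos_iff)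
  from curves[OF this] obtain g l where gl: "arclength_curve g l" "g ` {0..l} \<subseteq> ?\<Omega>" "g 0 = x" "g l = x0"
    and far: "\<forall>t\<in>{0..l}. bdist ?\<Omega> (g t) \<ge> C * t powr 1"
    unfolding Q_def by (elim exE conjE) (rule that)
  have "0 \<le> l" and cont: "continuous_on {0..l} g"
    and len: "\<And>t. t \<in> {0..l} \<Longrightarrow> curve_length g 0 t = ennreal t"
    using gl(1) by (auto simp: arclength_curve_def)
  \<comment> \<open>A curve from e - 1 to x0 must cross the line Re = 2 e - 1. By then its length is
    at least e, while the distance to the boundary is at most (2 e)^s.\<close>
  have "\<exists>t\<ge>0. t \<le> l \<and> Re (g t) = 2 * e - 1"
    using gl e \<open>0 \<le> l\<close> cont by (intro IVT') (auto simp: x_def intro!: continuous_intros)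
  then obtain t where t: "t \<in> {0..l}" "Re (g t) = 2 * e - 1" by auto
  have "e \<le> dist (g 0) (g t)"
    using abs_Re_le_cmod[of "g 0 - g t"] gl(3) t e by (simp add: dist_norm x_def)
  moreover have "dist (g 0) (g t) \<le> t"
    using curve_length_ge_dist[of 0 t g] len[OF t(1)] t(1) by (simp add: ennreal_le_iff)
  ultimately have "C * e \<le> C * t powr 1" using C t(1) by simp
  also have "\<dots> \<le> bdist ?\<Omega> (g t)" by (rule bspec[OF far t(1)])
  also have "\<dots> \<le> cusp_profile s (2 * e - 1)"
  proof -
    have "g t \<in> ?\<Omega>" using gl(2) t(1) by blast
    then show ?thesis using bdist_cusp_domain_le[of s "g t"] t(2) assms by simp
  qed
  also have "\<dots> = (2 * e) powr s" using e by (simp add: cusp_profile_eq)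
  also have "\<dots> = 2 powr s * e powr (s - 1) * e"
    using e powr_mult_base[of e "s - 1"] by (simp add: powr_mult mult.commute)
  also have "\<dots> < C * e" using e small by simp
  finally show False by simp
qed

section \<open>Parametrization and length of the boundary\<close>

text \<open>Since \<^const>\<open>cusp_profile\<close> vanishes outside the unit interval, only one of the
  two profile terms is nonzero at a time: the first traces the upper, the second the lower boundary arc.\<close>

definition cusp_boundary :: "real \<Rightarrow> real \<Rightarrow> complex" where
  "cusp_boundary s t =
     Complex (1 - \<bar>4 * t - 2\<bar>) (cusp_profile s (4 * t - 1) - cusp_profile s (3 - 4 * t))"

lemma cusp_boundary_upper:
  "0 \<le> t \<Longrightarrow> t \<le> 1/2 \<Longrightarrow> cusp_boundary s t = Complex (4 * t - 1) (cusp_profile s (4 * t - 1))"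
  using cusp_profile_eq_0_iff[of s "3 - 4 * t"] by (simp add: cusp_boundary_def)

lemma cusp_boundary_lower:
  "1/2 \<le> t \<Longrightarrow> t \<le> 1 \<Longrightarrow> cusp_boundary s t = Complex (3 - 4 * t) (- cusp_profile s (3 - 4 * t))"
  using cusp_profile_eq_0_iff[of s "4 * t - 1"] by (simp add: cusp_boundary_def)

lemma path_image_cusp_boundary:
  assumes "1 \<le> s"
  shows "path_image (cusp_boundary s) = frontier (cusp_domain s)"
  unfolding path_image_def
proof (intro equalityI subsetI)
  fix z assume "z \<in> cusp_boundary s ` {0..1}"
  then obtain t where t: "0 \<le> t" "t \<le> 1" "z = cusp_boundary s t" by auto
  show "z \<in> frontier (cusp_domain s)"
    using t by (cases "t \<le> 1/2")
      (auto simp: cusp_boundary_upper cusp_boundary_lower frontier_cusp_domain assms)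
next
  fix z assume "z \<in> frontier (cusp_domain s)"
  then have z: "\<bar>Re z\<bar> \<le> 1" "\<bar>Im z\<bar> = cusp_profile s (Re z)"
    by (auto simp: frontier_cusp_domain assms)
  show "z \<in> cusp_boundary s ` {0..1}"
  proof (cases "0 \<le> Im z")
    case True
    then have "z = cusp_boundary s ((Re z + 1) / 4)"
      using z by (subst cusp_boundary_upper) (auto simp: complex_eq_iff add_divide_distrib)
    then show ?thesis using z by (intro image_eqI[where x = "(Re z + 1) / 4"]) auto
  next
    case False
    then have "z = cusp_boundary s ((3 - Re z) / 4)"
      using z by (subst cusp_boundary_lower) (auto simp: complex_eq_iff diff_divide_distrib)
    then show ?thesis using z by (intro image_eqI[where x = "(3 - Re z) / 4"]) auto
  qed
qed

text \<open>Distinct parameters with equal real parts satisfy y = 1 - x, that is, they lie on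
  opposite arcs. Equal imaginary parts then force both profile terms to vanish, which happens only
  at the common endpoint -1.\<close>

lemma closed_simple_path_cusp_boundary:
  assumes "1 \<le> s"
  shows "closed_simple_path (cusp_boundary s)"
  unfolding closed_simple_path_def simple_path_def loop_free_def
proof (intro conjI ballI impI)
  show "path (cusp_boundary s)"
    unfolding path_def cusp_boundary_def Complex_eq using assms by (intro continuous_intros) auto
  show "pathfinish (cusp_boundary s) = pathstart (cusp_boundary s)"
    by (simp add: pathfinish_def pathstart_def cusp_boundary_def cusp_profile_def)
  fix x y :: real
  assume xy: "x \<in> {0..1}" "y \<in> {0..1}" "cusp_boundary s x = cusp_boundary s y"
  show "x = y \<or> x = 0 \<and> y = 1 \<or> x = 1 \<and> y = 0"
  proof (cases "x = y")
    case False
    have Re: "\<bar>4 * x - 2\<bar> = \<bar>4 * y - 2\<bar>"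
      and Im: "cusp_profile s (4 * x - 1) - cusp_profile s (3 - 4 * x)
        = cusp_profile s (4 * y - 1) - cusp_profile s (3 - 4 * y)"
      using xy(3) by (auto simp: cusp_boundary_def)
    have y: "y = 1 - x" using Re False by linarith
    have "cusp_profile s (4 * x - 1) = cusp_profile s (3 - 4 * x)"
      using Im unfolding y by (simp add: algebra_simps)
    moreover have "cusp_profile s (4 * x - 1) = 0 \<or> cusp_profile s (3 - 4 * x) = 0"
      by (auto simp: cusp_profile_eq_0_iff)
    ultimately have "cusp_profile s (4 * x - 1) = 0" "cusp_profile s (3 - 4 * x) = 0"
      by auto
    then have "1 \<le> \<bar>4 * x - 1\<bar>" "1 \<le> \<bar>3 - 4 * x\<bar>"
      by (auto simp: cusp_profile_eq_0_iff)
    then show ?thesis using False y xy(1) by auto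
  qed simp
qed

lemma curve_length_cusp_boundary:
  assumes "1 \<le> s"
  shows "curve_length (cusp_boundary s) 0 1 < \<infinity>"
proof -
  have "curve_length (cusp_boundary s) 0 1 \<le> ennreal ((4 + 8 * s) * (1 - 0))"
  proof (rule curve_length_Lipschitz)
    fix x y :: real assume "x \<le> y"
    let ?d = "cusp_boundary s x - cusp_boundary s y"
    have "\<bar>Re ?d\<bar> \<le> 4 * (y - x)" using \<open>x \<le> y\<close> by (simp add: cusp_boundary_def)
    moreover have "\<bar>Im ?d\<bar> \<le> s * \<bar>(4 * x - 1) - (4 * y - 1)\<bar> + s * \<bar>(3 - 4 * x) - (3 - 4 * y)\<bar>"
      using cusp_profile_Lipschitz[OF assms, of "4 * x - 1" "4 * y - 1"]
        cusp_profile_Lipschitz[OF assms, of "3 - 4 * x" "3 - 4 * y"]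
      unfolding cusp_boundary_def minus_complex.sel complex.sel by linarith
    moreover have "\<bar>(4 * x - 1) - (4 * y - 1)\<bar> = 4 * (y - x)" "\<bar>(3 - 4 * x) - (3 - 4 * y)\<bar> = 4 * (y - x)"
      using \<open>x \<le> y\<close> by auto
    ultimately have "norm ?d \<le> 4 * (y - x) + (s * (4 * (y - x)) + s * (4 * (y - x)))"
      using cmod_le[of ?d] by simp
    then show "dist (cusp_boundary s x) (cusp_boundary s y) \<le> (4 + 8 * s) * (y - x)"
      by (simp add: dist_norm algebra_simps)
  qed (use assms in simp)
  also have "\<dots> < \<infinity>" by simp
  finally show ?thesis .
qed

section \<open>Integrals of powers over the cusp domain\<close>

lemma nn_integral_inverse_shift_eq_infinity:
  "(\<integral>\<^sup>+x\<in>{-1<..<0}. ennreal (1 / (1 + x)) \<partial>lborel) = \<infinity>" (is "?I = \<infinity>")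
proof (rule ccontr)
  assume "?I \<noteq> \<infinity>"
  then obtain r where r: "?I = ennreal r" "0 \<le> r"
    by (cases ?I) auto
  obtain n :: nat where n: "r < real n" using reals_Archimedean2 by blast
  \<comment> \<open>Chosen so that ln (1/2) - ln (1 + a) is exactly n, which exceeds the supposed
    finite value r.\<close>
  define a where "a = exp (- real n) / 2 - 1"
  have exp_le: "exp (- real n) \<le> 1" by simp
  have a: "- 1 < a" "a \<le> -1/2" using exp_le by (simp_all add: a_def field_simps del: exp_le_one_iff)
  have "ennreal (real n) = ennreal (ln (1 + -1/2) - ln (1 + a))"
    by (simp add: a_def ln_div)
  also have "\<dots> = (\<integral>\<^sup>+x. ennreal (1 / (1 + x)) * indicator {a..-1/2} x \<partial>lborel)"
    using a by (intro nn_integral_FTC_Icc[symmetric]) (auto intro!: derivative_eq_intros)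
  also have "\<dots> \<le> ?I"
    using a by (intro nn_integral_mono) (auto split: split_indicator)
  finally have "real n \<le> r" using r by (simp add: ennreal_le_iff)
  then show False using n by simp
qed

lemma nn_integral_powr_shift_less_infinity:
  assumes "- 1 < q"
  shows "(\<integral>\<^sup>+x\<in>{-1<..<1}. ennreal ((1 + x) powr q) \<partial>lborel) < \<infinity>"
proof -
  have "(\<integral>\<^sup>+x\<in>{-1<..<1}. ennreal ((1 + x) powr q) \<partial>lborel)
      \<le> (\<integral>\<^sup>+x. ennreal (indicator {0..2} (1 + 1 * x) * (1 + 1 * x) powr q) \<partial>lborel)"
    by (intro nn_integral_mono) (auto split: split_indicator)
  also have "\<dots> = (\<integral>\<^sup>+x. ennreal (indicator {0..2} x * x powr q) \<partial>lborel)"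
    by (subst nn_integral_real_affine[of "\<lambda>x. ennreal (indicator {0..2} x * x powr q)" 1 1]) auto
  also have "\<dots> = ennreal (2 powr (q + 1) / (q + 1))"
    by (rule nn_integral_has_integral_lebesgue[OF _ has_integral_powr_from_0]) (use assms in auto)
  also have "\<dots> < \<infinity>" by simp
  finally show ?thesis .
qed

text \<open>By Tonelli: the integrand depends on Re z alone, and the vertical section at x has
  length 2 w(x). This reduces both area integrals to integrals over an interval.\<close>

lemma nn_integral_symmetric_strip:
  fixes h :: "real \<Rightarrow> ennreal" and w :: "real \<Rightarrow> real"
  assumes [measurable]: "h \<in> borel_measurable borel" "w \<in> borel_measurable borel" "A \<in> sets borel"
    and "\<And>x. 0 \<le> w x"
  shows "(\<integral>\<^sup>+z\<in>{z. Re z \<in> A \<and> \<bar>Im z\<bar> \<le> w (Re z)}. h (Re z) \<partial>lborel)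
       = (\<integral>\<^sup>+x\<in>A. h x * ennreal (2 * w x) \<partial>lborel)"
proof -
  have [measurable]: "Re \<in> borel_measurable borel" "Im \<in> borel_measurable borel"
    by (auto intro!: borel_measurable_continuous_onI continuous_intros)
  have "(\<integral>\<^sup>+z\<in>{z. Re z \<in> A \<and> \<bar>Im z\<bar> \<le> w (Re z)}. h (Re z) \<partial>lborel)
      = (\<integral>\<^sup>+x. \<integral>\<^sup>+y. h x * indicator {z. Re z \<in> A \<and> \<bar>Im z\<bar> \<le> w (Re z)} (Complex x y) \<partial>lborel \<partial>lborel)"
    by (subst nn_integral_complex_iterated) auto
  also have "\<dots> = (\<integral>\<^sup>+x. \<integral>\<^sup>+y. (h x * indicator A x) * indicator {- w x..w x} y \<partial>lborel \<partial>lborel)"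
    by (intro nn_integral_cong) (auto split: split_indicator)
  also have "\<dots> = (\<integral>\<^sup>+x\<in>A. h x * ennreal (2 * w x) \<partial>lborel)"
    using assms(4) by (intro nn_integral_cong, subst nn_integral_cmult_indicator) (auto simp: mult_ac)
  finally show ?thesis .
qed

lemma borel_measurable_cusp_profile [measurable]: "cusp_profile s \<in> borel_measurable borel"
  unfolding cusp_profile_def by measurable

text \<open>At the cusp the weight behaves like \<open>\<bar>z + 1\<bar> powr (s * e)\<close> and the cross section like
  \<open>\<bar>z + 1\<bar> powr s\<close>, so the critical exponent is \<open>b * p = s * (e + 1) + 1\<close>.\<close>

lemma cusp_integral_eq_infinity:
  assumes s: "1 \<le> s" and "0 < p" "0 \<le> b" "0 < K" and crit: "b * p = s * (e + 1) + 1"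
    and g: "\<And>z. z \<in> cusp_domain s \<Longrightarrow> norm (g z) = K * norm (z + 1) powr - b"
  shows "(\<integral>\<^sup>+z\<in>cusp_domain s. ennreal (norm (g z) powr p * bdist (cusp_domain s) z powr e) \<partial>lborel) = \<infinity>"
proof -
  \<comment> \<open>The factor 1/2 is the share of the gap that survives in the half-height strip S,
    and s + 1 comes from the lower bound on the boundary distance.\<close>
  define c where "c = 1 / (2 * (s + 1))"
  \<comment> \<open>The power of 2 accounts for |z + 1| \<le> 2 (1 + Re z) near the cusp.\<close>
  define \<kappa> where "\<kappa> = (K * 2 powr - b) powr p * c powr \<bar>e\<bar>"
  define r where "r = s * e - b * p"
  have c: "0 < c" "c \<le> 1" using s by (auto simp: c_def field_simps)
  have \<kappa>: "0 < \<kappa>" using c \<open>0 < K\<close> by (simp add: \<kappa>_def)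
  \<comment> \<open>On the strip of half height near -1, the boundary distance is comparable with
    the profile from both sides.\<close>
  define S where "S = {z. Re z \<in> {-1<..<0} \<and> \<bar>Im z\<bar> \<le> cusp_profile s (Re z) / 2}"
  have lower: "\<kappa> * (1 + Re z) powr r \<le> norm (g z) powr p * bdist (cusp_domain s) z powr e \<and> z \<in> cusp_domain s"
    if "z \<in> S" for z
  proof -
    define x where "x = 1 + Re z"
    have x: "0 < x" "x < 1" and Im: "\<bar>Im z\<bar> \<le> cusp_profile s (Re z) / 2"
      using that by (auto simp: S_def x_def)
    have \<phi>: "cusp_profile s (Re z) = x powr s"
      using x by (simp add: cusp_profile_def x_def)
    have z: "z \<in> cusp_domain s"
    proof -
      have "0 < x powr s" using x by simp
      then have "\<bar>Im z\<bar> < x powr s" using Im unfolding \<phi> by linarith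
      then show ?thesis by (simp add: cusp_domain_def \<phi>)
    qed
    have "norm (z + 1) \<le> x + \<bar>Im z\<bar>"
      using cmod_le[of "z + 1"] x by (simp add: x_def add.commute)
    also have "\<bar>Im z\<bar> \<le> x"
      using Im cusp_profile_le_linear[OF s, of "Re z"] cusp_profile_nonneg[of s "Re z"] x
      by (auto simp: x_def)
    finally have up: "norm (z + 1) \<le> 2 * x" by simp
    have "x \<le> norm (z + 1)" using abs_Re_le_cmod[of "z + 1"] by (simp add: x_def)
    then have pos: "0 < norm (z + 1)" using x by linarith
    have "2 powr - b * x powr - b \<le> norm (z + 1) powr - b"
      using powr_mono2'[OF _ pos up, of "- b"] \<open>0 \<le> b\<close> x by (simp add: powr_mult)
    then have "K * (2 powr - b * x powr - b) \<le> norm (g z)"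
      using g[OF z] \<open>0 < K\<close> by simp
    then have "(K * (2 powr - b * x powr - b)) powr p \<le> norm (g z) powr p"
      using \<open>0 < K\<close> \<open>0 < p\<close> by (intro powr_mono2) auto
    moreover have "(K * (2 powr - b * x powr - b)) powr p = (K * 2 powr - b) powr p * x powr - (b * p)"
      using \<open>0 < K\<close> x by (simp add: powr_mult powr_powr)
    moreover have "c powr \<bar>e\<bar> * (x powr s) powr e \<le> bdist (cusp_domain s) z powr e"
    proof (rule powr_lower_scale[OF c])
      have "c * x powr s = (cusp_profile s (Re z) / 2) / (s + 1)"
        using s by (simp add: c_def \<phi> field_simps)
      also have "\<dots> \<le> (cusp_profile s (Re z) - \<bar>Im z\<bar>) / (s + 1)"
        using Im s by (intro divide_right_mono) auto
      also have "\<dots> \<le> bdist (cusp_domain s) z" by (rule bdist_cusp_domain_ge[OF s])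
      finally show "c * x powr s \<le> bdist (cusp_domain s) z" .
      show "bdist (cusp_domain s) z \<le> x powr s"
        using bdist_cusp_domain_le[OF s z] \<phi> by simp
    qed (use x in simp)
    ultimately have "((K * 2 powr - b) powr p * x powr - (b * p)) * (c powr \<bar>e\<bar> * (x powr s) powr e)
        \<le> norm (g z) powr p * bdist (cusp_domain s) z powr e"
      by (intro mult_mono) auto
    moreover have "x powr r = x powr - (b * p) * (x powr s) powr e"
      using x by (simp add: powr_powr r_def flip: powr_add)
    then have "\<kappa> * x powr r = ((K * 2 powr - b) powr p * x powr - (b * p)) * (c powr \<bar>e\<bar> * (x powr s) powr e)"
      by (simp add: \<kappa>_def mult_ac)
    ultimately show ?thesis
      using z unfolding x_def by simp
  qed
  \<comment> \<open>The chain runs from the divergent integral of 1/(1+x) up to the area integral.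
    The critical exponent enters as r + s = -1, where the s comes from the cross section.\<close>
  have "\<infinity> = ennreal \<kappa> * (\<integral>\<^sup>+x\<in>{-1<..<0}. ennreal (1 / (1 + x)) \<partial>lborel)"
    using \<kappa> by (simp add: nn_integral_inverse_shift_eq_infinity ennreal_mult_top)
  also have "\<dots> = (\<integral>\<^sup>+x\<in>{-1<..<0}. ennreal (\<kappa> * (1 + x) powr r) * ennreal (2 * (cusp_profile s x / 2)) \<partial>lborel)"
  proof (subst nn_integral_cmult[symmetric], measurable, intro nn_integral_cong)
    fix x :: real
    have "\<kappa> * (1 / (1 + x)) = \<kappa> * (1 + x) powr r * (2 * (cusp_profile s x / 2))" if "x \<in> {-1<..<0}"
    proof -
      have "(1 + x) powr r * cusp_profile s x = (1 + x) powr (r + s)"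
        using that by (simp add: cusp_profile_def powr_add)
      also have "r + s = - 1" using crit by (simp add: r_def algebra_simps)
      also have "(1 + x) powr - 1 = 1 / (1 + x)"
        using that by (simp add: powr_minus_divide)
      finally show ?thesis
        by (simp only: mult.assoc nonzero_mult_div_cancel_left times_divide_eq_right[symmetric]) simp
    qed
    then show "ennreal \<kappa> * (ennreal (1 / (1 + x)) * indicator {-1<..<0} x)
        = ennreal (\<kappa> * (1 + x) powr r) * ennreal (2 * (cusp_profile s x / 2)) * indicator {-1<..<0} x"
      using \<kappa> by (auto split: split_indicator simp flip: ennreal_mult)
  qed
  also have "\<dots> = (\<integral>\<^sup>+z\<in>S. ennreal (\<kappa> * (1 + Re z) powr r) \<partial>lborel)"
    unfolding S_def by (subst nn_integral_symmetric_strip) auto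
  also have "\<dots> \<le> (\<integral>\<^sup>+z\<in>cusp_domain s. ennreal (norm (g z) powr p * bdist (cusp_domain s) z powr e) \<partial>lborel)"
    using lower by (intro nn_integral_mono) (auto split: split_indicator intro!: ennreal_leI)
  finally show ?thesis by (simp add: top_unique)
qed

text \<open>With e nonnegative, upper bounds on the boundary distance suffice. Bounding the profile
  by (1 + x)^s on all of (-1, 1) handles the cusp at 1 as well, and leaves an integral of (1 + x)^(r
  + s) with r + s > -1.\<close>

lemma cusp_integral_less_infinity:
  assumes s: "1 \<le> s" and "0 < p" "0 \<le> b" "0 \<le> e" "0 < K" and subcrit: "b * p < s * (e + 1) + 1"
    and g: "\<And>z. z \<in> cusp_domain s \<Longrightarrow> norm (g z) = K * norm (z + 1) powr - b"
  shows "(\<integral>\<^sup>+z\<in>cusp_domain s. ennreal (norm (g z) powr p * bdist (cusp_domain s) z powr e) \<partial>lborel) < \<infinity>"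
proof -
  define r where "r = s * e - b * p"
  define S where "S = {z. Re z \<in> {-1<..<1} \<and> \<bar>Im z\<bar> \<le> cusp_profile s (Re z)}"
  have \<phi>: "cusp_profile s x \<le> (1 + x) powr s" if "x \<in> {-1<..<1}" for x
    unfolding cusp_profile_def using s that by (intro powr_mono2) auto
  have upper: "norm (g z) powr p * bdist (cusp_domain s) z powr e \<le> K powr p * (1 + Re z) powr r \<and> z \<in> S"
    if z: "z \<in> cusp_domain s" for z
  proof -
    define x where "x = 1 + Re z"
    have Re: "Re z \<in> {-1<..<1}" using cusp_domain_Re[OF z] by auto
    then have x: "0 < x" by (simp add: x_def)
    have "x \<le> norm (z + 1)" using abs_Re_le_cmod[of "z + 1"] by (simp add: x_def)
    then have "norm (z + 1) powr - b \<le> x powr - b"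
      using powr_mono2'[of "- b" x "norm (z + 1)"] \<open>0 \<le> b\<close> x by simp
    then have "norm (g z) powr p \<le> (K * x powr - b) powr p"
      using g[OF z] \<open>0 < K\<close> \<open>0 < p\<close> by (intro powr_mono2) auto
    also have "\<dots> = K powr p * x powr - (b * p)"
      using \<open>0 < K\<close> x by (simp add: powr_mult powr_powr)
    finally have 1: "norm (g z) powr p \<le> K powr p * x powr - (b * p)" .
    have "bdist (cusp_domain s) z \<le> x powr s"
      using bdist_cusp_domain_le[OF s z] \<phi>[OF Re] by (simp add: x_def)
    then have 2: "bdist (cusp_domain s) z powr e \<le> (x powr s) powr e"
      using \<open>0 \<le> e\<close> by (intro powr_mono2) (auto simp: bdist_def infdist_nonneg)
    have "norm (g z) powr p * bdist (cusp_domain s) z powr e \<le> (K powr p * x powr - (b * p)) * (x powr s) powr e"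
      using 1 2 by (intro mult_mono) auto
    also have "\<dots> = K powr p * x powr r"
      using x by (simp add: powr_powr r_def mult.assoc flip: powr_add)
    finally show ?thesis using z Re by (simp add: x_def S_def cusp_domain_def)
  qed
  have "(\<integral>\<^sup>+z\<in>cusp_domain s. ennreal (norm (g z) powr p * bdist (cusp_domain s) z powr e) \<partial>lborel)
      \<le> (\<integral>\<^sup>+z\<in>S. ennreal (K powr p * (1 + Re z) powr r) \<partial>lborel)"
    using upper by (intro nn_integral_mono) (auto split: split_indicator intro!: ennreal_leI)
  also have "\<dots> = (\<integral>\<^sup>+x\<in>{-1<..<1}. ennreal (K powr p * (1 + x) powr r) * ennreal (2 * cusp_profile s x) \<partial>lborel)"
    unfolding S_def by (subst nn_integral_symmetric_strip) auto
  also have "\<dots> \<le> (\<integral>\<^sup>+x. ennreal (2 * K powr p) * (ennreal ((1 + x) powr (r + s)) * indicator {-1<..<1} x) \<partial>lborel)"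
  proof (intro nn_integral_mono)
    fix x :: real
    have "K powr p * (1 + x) powr r * (2 * cusp_profile s x) \<le> 2 * K powr p * (1 + x) powr (r + s)"
      if "x \<in> {-1<..<1}"
    proof -
      have "(2 * K powr p * (1 + x) powr r) * cusp_profile s x \<le> (2 * K powr p * (1 + x) powr r) * (1 + x) powr s"
        using \<phi>[OF that] by (intro mult_left_mono) auto
      then show ?thesis by (simp add: powr_add mult_ac)
    qed
    then show "ennreal (K powr p * (1 + x) powr r) * ennreal (2 * cusp_profile s x) * indicator {-1<..<1} x
        \<le> ennreal (2 * K powr p) * (ennreal ((1 + x) powr (r + s)) * indicator {-1<..<1} x)"
      by (auto split: split_indicator intro!: ennreal_leI simp flip: ennreal_mult)
  qed
  also have "\<dots> = ennreal (2 * K powr p) * (\<integral>\<^sup>+x\<in>{-1<..<1}. ennreal ((1 + x) powr (r + s)) \<partial>lborel)"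
    by (rule nn_integral_cmult) measurable
  also have "\<dots> < \<infinity>"
    using nn_integral_powr_shift_less_infinity[of "r + s"] subcrit
    by (auto simp: ennreal_mult_less_top r_def algebra_simps)
  finally show ?thesis .
qed

section \<open>The test function and the choice of its exponent\<close>

lemma higher_deriv_shifted_powr:
  fixes a :: real
  assumes "- 1 < Re z"
  shows "(deriv ^^ k) (\<lambda>z. (z + 1) powr of_real a) z
    = of_real (\<Prod>i<k. a - real i) * (z + 1) powr of_real (a - real k)"
  using assms
proof (induction k arbitrary: z)
  case (Suc k)
  let ?c = "complex_of_real (\<Prod>i<k. a - real i)" and ?H = "{z. - 1 < Re z}"
  \<comment> \<open>Differentiating the induction hypothesis requires it on a neighbourhood of z,
    hence the open half-plane.\<close>
  have "\<forall>\<^sub>F w in nhds z. w \<in> ?H"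
    using Suc.prems by (intro eventually_nhds_in_open open_halfspace_Re_gt) auto
  then have "\<forall>\<^sub>F w in nhds z. (deriv ^^ k) (\<lambda>z. (z + 1) powr of_real a) w = ?c * (w + 1) powr of_real (a - real k)"
    by eventually_elim (use Suc.IH in simp)
  then have "(deriv ^^ Suc k) (\<lambda>z. (z + 1) powr of_real a) z = deriv (\<lambda>w. ?c * (w + 1) powr of_real (a - real k)) z"
    by (simp add: deriv_cong_ev)
  also have "\<dots> = ?c * (of_real (a - real k) * (z + 1) powr (of_real (a - real k) - 1))"
  proof (rule DERIV_imp_deriv)
    have "z + 1 \<notin> \<real>\<^sub>\<le>\<^sub>0" using Suc.prems by (auto simp: complex_nonpos_Reals_iff)
    then show "((\<lambda>w. ?c * (w + 1) powr of_real (a - real k)) has_field_derivative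
        ?c * (of_real (a - real k) * (z + 1) powr (of_real (a - real k) - 1))) (at z)"
      by (auto intro!: derivative_eq_intros)
  qed
  also have "\<dots> = of_real (\<Prod>i<Suc k. a - real i) * (z + 1) powr of_real (a - real (Suc k))"
    by (simp add: algebra_simps)
  finally show ?case .
qed simp

text \<open>A real exponent makes the modulus of the power depend on |z + 1| alone. The exponent is
  written as -(k - a) to match the form -b of the integral estimates.\<close>

lemma norm_higher_deriv_shifted_powr:
  fixes a :: real
  assumes "- 1 < Re z"
  shows "norm ((deriv ^^ k) (\<lambda>z. (z + 1) powr of_real a) z)
    = \<bar>\<Prod>i<k. a - real i\<bar> * norm (z + 1) powr - (real k - a)"
  unfolding higher_deriv_shifted_powr[OF assms] norm_mult norm_of_real
  by (subst norm_powr_real_powr') auto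

theorem proposition6p1:
  fixes p s :: real and m :: nat
  assumes "1 < p" and "1 \<le> m" and "1 < s"
  shows "\<exists>(\<Omega> :: complex set) (f :: complex \<Rightarrow> complex).
    bounded \<Omega> \<and> simply_connected \<Omega> \<and> jordan_domain \<Omega> \<and> f analytic_on \<Omega> \<and>
    rectifiable_boundary \<Omega> \<and> s_john_domain s \<Omega> \<and> \<not> john_domain \<Omega> \<and>
    (\<forall>z0\<in>\<Omega>.
      (\<integral>\<^sup>+z\<in>\<Omega>. ennreal (norm ((deriv ^^ m) f z) powr p * bdist \<Omega> z powr (real m * p - 2)) \<partial>lborel) = \<infinity> \<and>
      ennreal (norm ((deriv ^^ m) f z0) powr p * bdist \<Omega> z0 powr (real m * p)) +
      (\<integral>\<^sup>+z\<in>\<Omega>. ennreal (norm ((deriv ^^ (m + 1)) f z) powr p * bdist \<Omega> z powr (real (m + 1) * p - 2)) \<partial>lborel) < \<infinity>)"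
proof -
  define \<Omega> where "\<Omega> = cusp_domain s"
  \<comment> \<open>Solves the critical equation b p = s (e + 1) + 1 for the weight exponent e = m p
    - 2.\<close>
  define b where "b = (s * (real m * p - 1) + 1) / p"
  \<comment> \<open>Makes the m-th derivative a constant multiple of the power with exponent a - m =
    -b.\<close>
  define a where "a = real m - b"
  define f where "f = (\<lambda>z :: complex. (z + 1) powr of_real a)"
  have s: "1 \<le> s" using assms by simp
  have mp: "p \<le> real m * p" using assms by simp
  have bp: "b * p = s * (real m * p - 1) + 1" using assms by (simp add: b_def)
  have "1 * (real m * p - 1) < s * (real m * p - 1)"
    using assms(1,3) mp by (intro mult_strict_right_mono) linarith+
  then have "real m * p < b * p" using bp by simp
  \<comment> \<open>Hence a is negative, so no factor a - i vanishes and the constants in front of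
    the derivatives are nonzero.\<close>
  then have mb: "real m < b" using assms by simp
  have f': "norm ((deriv ^^ k) f z) = \<bar>\<Prod>i<k. a - real i\<bar> * norm (z + 1) powr - (real k - a)"
    if "z \<in> \<Omega>" for k z
    unfolding f_def using cusp_domain_Re[of z s] that
    by (intro norm_higher_deriv_shifted_powr) (auto simp: \<Omega>_def)
  have K: "0 < \<bar>\<Prod>i<k. a - real i\<bar>" for k using mb by (auto simp: a_def)
  have infinite: "(\<integral>\<^sup>+z\<in>\<Omega>. ennreal (norm ((deriv ^^ m) f z) powr p * bdist \<Omega> z powr (real m * p - 2)) \<partial>lborel) = \<infinity>"
    unfolding \<Omega>_def
    by (rule cusp_integral_eq_infinity[OF s _ _ K])
      (use assms mb bp f' in \<open>auto simp: a_def \<Omega>_def algebra_simps\<close>)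
  have finite: "(\<integral>\<^sup>+z\<in>\<Omega>. ennreal (norm ((deriv ^^ (m + 1)) f z) powr p * bdist \<Omega> z powr (real (m + 1) * p - 2)) \<partial>lborel) < \<infinity>"
    unfolding \<Omega>_def
  proof (rule cusp_integral_less_infinity[OF s _ _ _ K])
    show "norm ((deriv ^^ (m + 1)) f z) = \<bar>\<Prod>i<m + 1. a - real i\<bar> * norm (z + 1) powr - (b + 1)"
      if "z \<in> cusp_domain s" for z
      using f'[of z "m + 1"] that unfolding \<Omega>_def a_def by (simp add: algebra_simps)
    \<comment> \<open>One more derivative raises b p by p, while the weight raises the critical
      value by s p; s > 1 makes the new exponent subcritical.\<close>
    have "p < s * p" using assms by simp
    then show "(b + 1) * p < s * (real (m + 1) * p - 2 + 1) + 1"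
      using bp by (simp add: algebra_simps)
    show "0 \<le> real (m + 1) * p - 2"
    proof -
      have "real (m + 1) * p = real m * p + p" by (simp add: algebra_simps)
      then show ?thesis using mp assms(1) by linarith
    qed
  qed (use assms mb in auto)
  \<comment> \<open>On the domain z + 1 has positive real part, so it avoids the branch cut of the
    power.\<close>
  have "f holomorphic_on \<Omega>"
    unfolding f_def \<Omega>_def using cusp_domain_Re[of _ s]
    by (intro holomorphic_intros) (force simp: complex_nonpos_Reals_iff)
  then have "f analytic_on \<Omega>"
    using analytic_on_open[OF open_cusp_domain[OF s]] by (simp add: \<Omega>_def)
  moreover have "jordan_domain \<Omega>" "rectifiable_boundary \<Omega>"
    unfolding \<Omega>_def jordan_domain_def rectifiable_boundary_def
    using domain_cusp_domain bounded_cusp_domain closed_simple_path_cusp_boundary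
      path_image_cusp_boundary curve_length_cusp_boundary s by blast+
  moreover have "bounded \<Omega>" "simply_connected \<Omega>" "s_john_domain s \<Omega>" "\<not> john_domain \<Omega>"
    unfolding \<Omega>_def using s assms bounded_cusp_domain starlike_cusp_domain
      starlike_imp_simply_connected s_john_cusp_domain not_john_cusp_domain by blast+
  \<comment> \<open>The term at z0 is \<open>ennreal\<close> of a real number and therefore finite
    for every z0, so only the integral had to be estimated.\<close>
  ultimately show ?thesis
    using infinite finite by (intro exI[of _ \<Omega>] exI[of _ f]) (simp add: less_top)
qed

end
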